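(* Let $\nu<\kappa$ be regular cardinals with $\nu\ge\omega_1$, and let $\mu<\lambda$ be cardinals with $\mu\ge\kappa$. Assume $\operatorname{cov}(\lambda,\mu^+,\mu^+,\nu)=\lambda$. Suppose $\{c_\xi:\xi<\mu\}\subseteq\mathcal P_\nu\mu$ and $T$ is a stationary subset of $\mathcal P_\kappa\mu$ with $|T|=\mu$ such that for every $z\in T$ the family $\{c_\xi:\xi\in z\}$ is unbounded in $\mathcal P_\nu z$. Then $\mathcal P_\kappa\lambda$ has a $\mu$-nonreflecting stationary subset, i.e. there is a stationary $S\subseteq\mathcal P_\kappa\lambda$ such that $S\cap\mathcal P_\kappa A$ is nonstationary in $\mathcal P_\kappa A$ for every $A$ with $\mu\subseteq A\subseteq\lambda$ and $|A|=\mu$.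
   Context: For a set $X$ and a cardinal $\kappa$, $\mathcal P_\kappa X=\{x\subseteq X:|x|<\kappa\}$, and $[X]^\mu=\{x\subseteq X:|x|=\mu\}$. For $|X|\ge\kappa$ with $\kappa$ regular uncountable, a set $C\subseteq\mathcal P_\kappa X$ is club if it is cofinal under $\subseteq$ and closed under unions of $\subseteq$-increasing chains of length $<\kappa$; a set is stationary in $\mathcal P_\kappa X$ if it meets every club subset of $\mathcal P_\kappa X$, nonstationary otherwise. A family $Y\subseteq\mathcal P_\nu z$ is unbounded in $\mathcal P_\nu z$ if every $x\in\mathcal P_\nu z$ is contained in some $y\in Y$. $\operatorname{cov}(\lambda,\mu^+,\mu^+,\nu)=\lambda$ means: there exist sets $E_\alpha\in[\lambda]^\mu$ ($\alpha<\lambda$) such that for every $B\in[\lambda]^\mu$ there is $a\in\mathcal P_\nu\lambda$ with $B\subseteq\bigcup_{\alpha\in a}E_\alpha$. *)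

theory Defs
  imports Main
begin

unbundle cardinal_syntax

text \<open>
  A cardinal is a relation \<open>r\<close> with \<open>Card_order r\<close>; as a von Neumann ordinal it is the set
  \<open>Field r\<close>, and an ordinal below \<open>r\<close> is \<open>underS r \<delta>\<close> for a unique \<open>\<delta> \<in> Field r\<close>.
\<close>

definition P_less :: "'k rel \<Rightarrow> 'a set \<Rightarrow> 'a set set" where
  "P_less \<kappa> X = {x. x \<subseteq> X \<and> |x| <o \<kappa>}"

definition P_eq :: "'k rel \<Rightarrow> 'a set \<Rightarrow> 'a set set" where
  "P_eq \<mu> X = {x. x \<subseteq> X \<and> |x| =o \<mu>}"

text \<open>
  Chains are sequences \<open>f\<close> of length \<open>underS \<kappa> \<delta>\<close>. The empty chain has to be excluded: otherwise
  every club would contain \<open>{}\<close>.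
\<close>

definition club :: "'k rel \<Rightarrow> 'a set \<Rightarrow> 'a set set \<Rightarrow> bool" where
  "club \<kappa> X C \<longleftrightarrow>
     C \<subseteq> P_less \<kappa> X \<and>
     (\<forall>x \<in> P_less \<kappa> X. \<exists>y \<in> C. x \<subseteq> y) \<and>
     (\<forall>\<delta> \<in> Field \<kappa>. \<forall>f :: 'k \<Rightarrow> 'a set.
        underS \<kappa> \<delta> \<noteq> {} \<and>
        (\<forall>i \<in> underS \<kappa> \<delta>. f i \<in> C) \<and>
        (\<forall>i \<in> underS \<kappa> \<delta>. \<forall>j \<in> underS \<kappa> \<delta>. (i, j) \<in> \<kappa> \<longrightarrow> f i \<subseteq> f j)
        \<longrightarrow> (\<Union>i \<in> underS \<kappa> \<delta>. f i) \<in> C)"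

definition stationary :: "'k rel \<Rightarrow> 'a set \<Rightarrow> 'a set set \<Rightarrow> bool" where
  "stationary \<kappa> X S \<longleftrightarrow> S \<subseteq> P_less \<kappa> X \<and> (\<forall>C. club \<kappa> X C \<longrightarrow> S \<inter> C \<noteq> {})"

definition unbounded_in :: "'n rel \<Rightarrow> 'a set \<Rightarrow> 'a set set \<Rightarrow> bool" where
  "unbounded_in \<nu> z Y \<longleftrightarrow> Y \<subseteq> P_less \<nu> z \<and> (\<forall>x \<in> P_less \<nu> z. \<exists>y \<in> Y. x \<subseteq> y)"

text \<open>The assertion \<open>cov(\<Lambda>, \<mu>\<^sup>+, \<mu>\<^sup>+, \<nu>) = \<Lambda>\<close>.\<close>

definition cov_eq :: "'a rel \<Rightarrow> 'm rel \<Rightarrow> 'n rel \<Rightarrow> bool" where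
  "cov_eq \<Lambda> \<mu> \<nu> \<longleftrightarrow>
     (\<exists>E :: 'a \<Rightarrow> 'a set.
        (\<forall>\<alpha> \<in> Field \<Lambda>. E \<alpha> \<in> P_eq \<mu> (Field \<Lambda>)) \<and>
        (\<forall>B \<in> P_eq \<mu> (Field \<Lambda>). \<exists>a \<in> P_less \<nu> (Field \<Lambda>). B \<subseteq> (\<Union>\<alpha> \<in> a. E \<alpha>)))"

text \<open>
  The cardinal \<open>\<mu>\<close> is a relation on the same type as \<open>\<Lambda>\<close>, so that \<open>Field \<mu>\<close> is a subset
  of \<open>Field \<Lambda>\<close> when \<open>\<mu>\<close> is an initial segment of \<open>\<Lambda>\<close>.
\<close>

definition nonreflecting_stationary :: "'k rel \<Rightarrow> 'a rel \<Rightarrow> 'a rel \<Rightarrow> 'a set set \<Rightarrow> bool" where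
  "nonreflecting_stationary \<kappa> \<mu> \<Lambda> S \<longleftrightarrow>
     stationary \<kappa> (Field \<Lambda>) S \<and>
     (\<forall>A. Field \<mu> \<subseteq> A \<and> A \<subseteq> Field \<Lambda> \<and> |A| =o \<mu> \<longrightarrow>
        \<not> stationary \<kappa> A (S \<inter> P_less \<kappa> A))"

end

theory Submission
  imports Defs
begin

text \<open>
  Write \<open>E[b]\<close> for \<open>\<Union>\<alpha>\<in>b. E \<alpha>\<close>, where \<open>E\<close> witnesses the covering hypothesis, and fix for every
  \<open>B \<subseteq> \<lambda>\<close> of size at most \<open>\<mu>\<close> a map \<open>e B\<close> of \<open>\<mu>\<close> onto a superset of \<open>B\<close>. The nonreflecting set
  consists of the \<open>x\<close> with \<open>z = x \<inter> \<mu> \<in> T\<close> which are covered by an \<open>E\<close>-closed set \<open>B = E[b]\<close> with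
  \<open>b \<in> P\<^sub>\<nu> x\<close> but are not contained in \<open>e B ` z\<close>. The set \<open>B\<close> is determined by \<open>x\<close>, being the
  \<open>E\<close>-closure of \<open>x\<close>.

  Nonreflection: let \<open>m\<close> be a bijection from \<open>\<mu>\<close> to \<open>A\<close>. For club many \<open>x \<in> P\<^sub>\<kappa> A\<close> we have
  \<open>x = m[z]\<close>, so \<open>b\<close> is contained in some \<open>m[c \<xi>]\<close> with \<open>\<xi> \<in> z\<close>, whence \<open>E[b] = E[m[c \<xi>]]\<close> and, for
  club many \<open>x\<close>, this set contains \<open>A\<close>. By minimality it does not depend on \<open>x\<close>, and then
  \<open>x \<subseteq> e B ` z\<close> for club many \<open>x\<close>.

  Stationarity: given a club, consider for \<open>z \<in> T\<close> the game of length \<open>\<omega>\<close> in which the opponent names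
  sets \<open>G\<close> of size \<open>\<mu>\<close> and we extend \<open>b \<in> P\<^sub>\<nu> \<lambda>\<close> so that \<open>G \<subseteq> E[b]\<close>, keeping the trace on \<open>\<mu>\<close> of
  the hull of \<open>z \<union> b\<close> equal to \<open>z\<close>. As \<open>|T| = \<mu>\<close>, the opponent cannot win for all \<open>z \<in> T\<close>. For a
  good \<open>z\<close> we interleave \<open>\<kappa>\<close> many plays so that all of them end with the same \<open>B = E[b]\<close>. The
  resulting hulls have union of size at least \<open>\<kappa> > |z|\<close>, so one of them is not inside \<open>e B ` z\<close>.
\<close>

subsection \<open>Clubs in \<open>P\<^sub>\<kappa> X\<close>\<close>

lemma finite_imp_ordLess_Cinfinite:
  assumes "finite A" "Cinfinite r"
  shows "|A| <o r"
  using ordLess_ordLeq_trans[OF _ natLeq_ordLeq_cinfinite[OF assms(2)]] assms(1)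
  by (simp add: finite_iff_ordLess_natLeq)

text \<open>Countably many stages \<open>A n\<close>, each inserting one more element of
  \<open>x\<close>, exhaust the finite subsets. Stability bounds each stage and, as
  \<open>\<kappa>\<close> is uncountable, their union.\<close>

lemma card_finite_subsets_ordLess:
  fixes x :: "'x set"
  assumes st: "stable \<kappa>" and inf: "natLeq <o \<kappa>" and x: "|x| <o \<kappa>"
  shows "|{s. finite s \<and> s \<subseteq> x}| <o \<kappa>"
proof -
  define A where "A = rec_nat {{}} (\<lambda>_ B. \<Union>a\<in>x. insert a ` B)"
  have fin: "|B| <o \<kappa>" if "finite B" for B :: "'x set set"
    using that inf finite_iff_ordLess_natLeq ordLess_transitive by blast
  have small: "|A n| <o \<kappa>" for n
  proof (induction n)
    case 0
    then show ?case using fin[of "{{}}"] by (simp add: A_def)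
  next
    case (Suc n)
    have "|insert a ` A n| <o \<kappa>" for a
      using Suc card_of_image ordLeq_ordLess_trans by blast
    then have "|\<Union>a\<in>x. insert a ` A n| <o \<kappa>"
      by (intro stable_UNION[OF st x])
    then show ?case by (simp add: A_def)
  qed
  have nat: "|UNIV :: nat set| <o \<kappa>"
    using inf card_of_nat ordIso_ordLess_trans by blast
  have mem: "s \<in> (\<Union>n. A n)" if "finite s" "s \<subseteq> x" for s
    using that
  proof (induction s)
    case empty
    have "{} \<in> A 0" by (simp add: A_def)
    then show ?case by blast
  next
    case (insert a s)
    then obtain n where "s \<in> A n" by auto
    with insert have "insert a s \<in> A (Suc n)" by (auto simp: A_def)
    then show ?case by blast
  qed
  have "|\<Union>n. A n| <o \<kappa>"
    using stable_UNION[OF st nat] small by blast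
  moreover have "|{s. finite s \<and> s \<subseteq> x}| \<le>o |\<Union>n. A n|"
    using mem by (intro card_of_mono1) blast
  ultimately show ?thesis using ordLeq_ordLess_trans by blast
qed

lemma finite_subset_chain_UN:
  assumes "finite s" "I \<noteq> {}" "s \<subseteq> (\<Union>i\<in>I. f i)"
    and "\<And>i j. i \<in> I \<Longrightarrow> j \<in> I \<Longrightarrow> f i \<subseteq> f j \<or> f j \<subseteq> f i"
  shows "\<exists>i\<in>I. s \<subseteq> f i"
  using assms(1,3)
proof (induction s)
  case empty
  then show ?case using assms(2) by auto
next
  case (insert a s)
  then obtain i j where "i \<in> I" "s \<subseteq> f i" "j \<in> I" "a \<in> f j" by auto
  with assms(4)[of i j] show ?case by blast
qed

lemma P_less_Un:
  assumes "\<not> finite (Field r)" "Card_order r" "x \<in> P_less r X" "y \<in> P_less r X"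
  shows "x \<union> y \<in> P_less r X"
  using assms card_of_Un_ordLess_infinite_Field[OF assms(1,2), of x y] by (simp add: P_less_def)

lemma P_less_mono: "x \<in> P_less r X \<Longrightarrow> X \<subseteq> Y \<Longrightarrow> x \<in> P_less r Y"
  unfolding P_less_def by blast

lemma P_less_subset: "x \<in> P_less r X \<Longrightarrow> y \<subseteq> x \<Longrightarrow> y \<in> P_less r X"
  unfolding P_less_def using ordLeq_ordLess_trans[OF card_of_mono1] by blast

lemma P_less_countable_UN:
  assumes "stable r" "natLeq <o r" "\<And>n :: nat. f n \<in> P_less r X"
  shows "(\<Union>n. f n) \<in> P_less r X"
proof -
  have "|UNIV :: nat set| <o r" using ordIso_ordLess_trans[OF card_of_nat assms(2)] .
  then have "|\<Union>n. f n| <o r"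
    using assms(3) by (intro stable_UNION[OF assms(1)]) (auto simp: P_less_def)
  then show ?thesis using assms(3) by (auto simp: P_less_def)
qed

lemma P_less_finite: "natLeq <o r \<Longrightarrow> finite x \<Longrightarrow> x \<subseteq> X \<Longrightarrow> x \<in> P_less r X"
  unfolding P_less_def using ordLess_transitive[of "|x|" natLeq r] by (simp add: finite_iff_ordLess_natLeq)

lemma club_imp_P_less: "club \<kappa> X C \<Longrightarrow> y \<in> C \<Longrightarrow> y \<in> P_less \<kappa> X"
  unfolding club_def by blast

lemma club_cofinal: "club \<kappa> X C \<Longrightarrow> x \<in> P_less \<kappa> X \<Longrightarrow> \<exists>y\<in>C. x \<subseteq> y"
  unfolding club_def by blast

text \<open>\<open>club\<close> speaks only of chains along \<open>underS \<kappa> \<delta>\<close>;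
  a well-order below \<open>\<kappa>\<close> is isomorphic to such a segment, which transports the
  chain.\<close>

lemma club_Union_chain:
  assumes C: "club \<kappa> X C" and k: "Well_order \<kappa>" and r: "Well_order r" "r <o \<kappa>" "Field r \<noteq> {}"
    and f: "\<And>i. i \<in> Field r \<Longrightarrow> f i \<in> C" "\<And>i j. (i, j) \<in> r \<Longrightarrow> f i \<subseteq> f j"
  shows "(\<Union>i\<in>Field r. f i) \<in> C"
proof -
  obtain \<delta> where d: "\<delta> \<in> Field \<kappa>" "r =o Restr \<kappa> (underS \<kappa> \<delta>)"
    using ordLess_iff_ordIso_Restr[OF k r(1)] r(2) by blast
  obtain g where g: "iso (Restr \<kappa> (underS \<kappa> \<delta>)) r g"
    using ordIso_symmetric[OF d(2)] unfolding ordIso_def by blast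
  have fld: "Field (Restr \<kappa> (underS \<kappa> \<delta>)) = underS \<kappa> \<delta>"
    using k by (simp add: wo_rel_def wo_rel.underS_ofilter Field_Restr_ofilter)
  have im: "g ` underS \<kappa> \<delta> = Field r"
    using g fld unfolding iso_iff2 bij_betw_def by simp
  have "underS \<kappa> \<delta> \<noteq> {}" using im r(3) by auto
  moreover have "\<forall>i \<in> underS \<kappa> \<delta>. (f \<circ> g) i \<in> C" using im f(1) by auto
  moreover have "\<forall>i \<in> underS \<kappa> \<delta>. \<forall>j \<in> underS \<kappa> \<delta>. (i, j) \<in> \<kappa> \<longrightarrow> (f \<circ> g) i \<subseteq> (f \<circ> g) j"
  proof (intro ballI impI)
    fix i j assume "i \<in> underS \<kappa> \<delta>" "j \<in> underS \<kappa> \<delta>" "(i, j) \<in> \<kappa>"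
    then have "(i, j) \<in> Restr \<kappa> (underS \<kappa> \<delta>)" by blast
    then show "(f \<circ> g) i \<subseteq> (f \<circ> g) j" using iso_forward[OF _ g] f(2) by simp
  qed
  ultimately have "(\<Union>i\<in>underS \<kappa> \<delta>. (f \<circ> g) i) \<in> C"
    using C d(1) unfolding club_def by blast
  moreover have "(\<Union>i\<in>underS \<kappa> \<delta>. (f \<circ> g) i) = (\<Union>i\<in>Field r. f i)"
    unfolding im[symmetric] by simp
  ultimately show ?thesis by simp
qed

text \<open>Cofinality by closing off \<omega> times: a finite subset of the union lies in some
  stage, so its value lies in the next one.\<close>

lemma club_closure_points:
  fixes \<kappa> :: "'k rel" and X :: "'a set"
  assumes k: "Card_order \<kappa>" "stable \<kappa>" "natLeq <o \<kappa>"
    and K: "\<And>s. finite s \<Longrightarrow> s \<subseteq> X \<Longrightarrow> K s \<in> P_less \<kappa> X"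
  shows "club \<kappa> X {x \<in> P_less \<kappa> X. \<forall>s. finite s \<and> s \<subseteq> x \<longrightarrow> K s \<subseteq> x}"
    (is "club \<kappa> X ?D")
  unfolding club_def
proof (intro conjI ballI allI impI)
  show "?D \<subseteq> P_less \<kappa> X" by blast
next
  fix x assume x: "x \<in> P_less \<kappa> X"
  define st where "st y = y \<union> (\<Union>s\<in>{s. finite s \<and> s \<subseteq> y}. K s)" for y
  define f where "f n = (st ^^ n) x" for n
  have inf: "\<not> finite (Field \<kappa>)"
    using cinfinite_mono[OF ordLess_imp_ordLeq[OF k(3)] natLeq_cinfinite]
    by (simp add: cinfinite_def)
  have stP: "st y \<in> P_less \<kappa> X" if y: "y \<in> P_less \<kappa> X" for y
  proof -
    have "|\<Union>s\<in>{s. finite s \<and> s \<subseteq> y}. K s| <o \<kappa>"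
      using y K by (intro stable_UNION[OF k(2)] card_finite_subsets_ordLess k) (auto simp: P_less_def)
    then have "|st y| <o \<kappa>"
      unfolding st_def using y inf k(1)
      by (intro card_of_Un_ordLess_infinite_Field) (auto simp: P_less_def)
    moreover have "st y \<subseteq> X"
    proof -
      have "y \<subseteq> X" using y by (simp add: P_less_def)
      then have "K s \<subseteq> X" if "finite s" "s \<subseteq> y" for s
        using K[of s] that by (simp add: P_less_def)
      with \<open>y \<subseteq> X\<close> show ?thesis unfolding st_def by blast
    qed
    ultimately show ?thesis by (simp add: P_less_def)
  qed
  have fS: "f (Suc n) = st (f n)" for n by (simp add: f_def)
  have fP: "f n \<in> P_less \<kappa> X" for n
    by (induction n) (auto simp: fS stP, simp add: f_def x)
  have "f n \<subseteq> f (Suc n)" for n unfolding fS st_def by blast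
  then have mono: "m \<le> n \<Longrightarrow> f m \<subseteq> f n" for m n by (rule lift_Suc_mono_le)
  have nat: "|UNIV :: nat set| <o \<kappa>"
    using k(3) card_of_nat ordIso_ordLess_trans by blast
  have "|\<Union>n. f n| <o \<kappa>"
    using stable_UNION[OF k(2) nat] fP by (auto simp: P_less_def)
  moreover have "K s \<subseteq> (\<Union>n. f n)" if s: "finite s" "s \<subseteq> (\<Union>n. f n)" for s
  proof -
    obtain n where "s \<subseteq> f n"
      using finite_subset_chain_UN[OF s(1) UNIV_not_empty s(2)] mono
      by (meson linear)
    then have "K s \<subseteq> f (Suc n)" using s unfolding fS st_def by blast
    then show ?thesis by blast
  qed
  ultimately have "(\<Union>n. f n) \<in> ?D" using fP by (auto simp: P_less_def)
  moreover have "x \<subseteq> (\<Union>n. f n)" using UN_upper[of 0 UNIV f] by (simp add: f_def)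
  ultimately show "\<exists>y\<in>?D. x \<subseteq> y" by blast
next
  fix \<delta> and f :: "'k \<Rightarrow> 'a set"
  assume d: "\<delta> \<in> Field \<kappa>" and
    f: "underS \<kappa> \<delta> \<noteq> {} \<and> (\<forall>i\<in>underS \<kappa> \<delta>. f i \<in> ?D) \<and>
       (\<forall>i\<in>underS \<kappa> \<delta>. \<forall>j\<in>underS \<kappa> \<delta>. (i, j) \<in> \<kappa> \<longrightarrow> f i \<subseteq> f j)"
  have "|\<Union>i\<in>underS \<kappa> \<delta>. f i| <o \<kappa>"
    using f by (intro stable_UNION[OF k(2)] card_of_underS k d) (auto simp: P_less_def)
  moreover have "K s \<subseteq> (\<Union>i\<in>underS \<kappa> \<delta>. f i)"
    if s: "finite s" "s \<subseteq> (\<Union>i\<in>underS \<kappa> \<delta>. f i)" for s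
  proof -
    have tot: "f i \<subseteq> f j \<or> f j \<subseteq> f i" if ij: "i \<in> underS \<kappa> \<delta>" "j \<in> underS \<kappa> \<delta>" for i j
    proof (cases "i = j")
      case False
      have "i \<in> Field \<kappa>" "j \<in> Field \<kappa>" using ij underS_Field by fast+
      with False have "(i, j) \<in> \<kappa> \<or> (j, i) \<in> \<kappa>"
        using k(1) unfolding card_order_on_def well_order_on_def linear_order_on_def total_on_def
        by simp
      with f ij show ?thesis by simp blast
    qed simp
    have ne: "underS \<kappa> \<delta> \<noteq> {}" using f by simp
    obtain i where i: "i \<in> underS \<kappa> \<delta>" "s \<subseteq> f i"
      using finite_subset_chain_UN[OF s(1) ne s(2) tot] by (rule bexE)
    then have "K s \<subseteq> f i" using f s(1) by simp
    with i(1) show ?thesis by blast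
  qed
  ultimately show "(\<Union>i\<in>underS \<kappa> \<delta>. f i) \<in> ?D"
    using f by (auto simp: P_less_def)
qed

lemma stationary_closure_point:
  assumes "Card_order \<kappa>" "stable \<kappa>" "natLeq <o \<kappa>" and S: "stationary \<kappa> X S"
    and "\<And>s. finite s \<Longrightarrow> s \<subseteq> X \<Longrightarrow> K s \<in> P_less \<kappa> X"
  shows "\<exists>x\<in>S. \<forall>s. finite s \<and> s \<subseteq> x \<longrightarrow> K s \<subseteq> x"
proof -
  let ?D = "{x \<in> P_less \<kappa> X. \<forall>s. finite s \<and> s \<subseteq> x \<longrightarrow> K s \<subseteq> x}"
  have "club \<kappa> X ?D" by (rule club_closure_points) (use assms in auto)
  then have "S \<inter> ?D \<noteq> {}" using S unfolding stationary_def by simp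
  then obtain x where "x \<in> S" "x \<in> ?D" by blast
  then show ?thesis by (intro bexI[of _ x]) simp_all
qed

text \<open>Recursion along proper inclusion: a finite \<open>s\<close> has finitely many proper
  subsets, so \<open>s\<close> and their values together still have size below
  \<open>\<kappa>\<close> and are covered by a member of the club.\<close>

lemma club_monotone_selection:
  assumes k: "Cinfinite \<kappa>" and C: "club \<kappa> X C"
  shows "\<exists>F. \<forall>s. finite s \<and> s \<subseteq> X \<longrightarrow> F s \<in> C \<and> s \<subseteq> F s \<and> (\<forall>t. t \<subseteq> s \<longrightarrow> F t \<subseteq> F s)"
proof -
  define H where "H f s = (SOME y. y \<in> C \<and> s \<union> (\<Union>t\<in>{t. t \<subset> s}. f t) \<subseteq> y)" for f :: "'b set \<Rightarrow> 'b set" and s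
  define F where "F = wfrec finite_psubset H"
  have F: "F s = H F s" if "finite s" for s
  proof -
    have "F s = H (cut F finite_psubset s) s"
      unfolding F_def by (rule wfrec[OF wf_finite_psubset])
    also have "\<dots> = H F s"
    proof -
      \<comment> \<open>\<open>H\<close> reads its first argument only at proper subsets of the
        finite set \<open>s\<close>, where \<open>cut\<close> changes nothing.\<close>
      have "(\<Union>t\<in>{t. t \<subset> s}. cut F finite_psubset s t) = (\<Union>t\<in>{t. t \<subset> s}. F t)"
        using that by (intro SUP_cong) (auto simp: cut_def finite_psubset_def)
      then show ?thesis unfolding H_def by simp
    qed
    finally show ?thesis .
  qed
  have main: "F s \<in> C \<and> s \<union> (\<Union>t\<in>{t. t \<subset> s}. F t) \<subseteq> F s" if "finite s" "s \<subseteq> X" for s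
    using that
  proof (induction s rule: finite_psubset_induct)
    case (psubset s)
    have Ft: "F t \<in> P_less \<kappa> X" if "t \<subset> s" for t
      using club_imp_P_less[OF C] psubset.IH[OF that] psubset.prems that by blast
    moreover have "|s \<union> (\<Union>t\<in>{t. t \<subset> s}. F t)| <o \<kappa>"
    proof (intro card_of_Un_ordLess_infinite_Field)
      show "|\<Union>t\<in>{t. t \<subset> s}. F t| <o \<kappa>"
      proof -
        have "finite {t. t \<subset> s}"
          using finite_subset[of "{t. t \<subset> s}" "Pow s"] psubset(1) by auto
        moreover have "|\<Union>t\<in>J. F t| <o \<kappa>" if "finite J" "\<And>t. t \<in> J \<Longrightarrow> |F t| <o \<kappa>" for J
          using that
        proof (induction J rule: finite_induct)
          case empty
          then show ?case using finite_imp_ordLess_Cinfinite[OF _ k, of "{}"] by simp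
        next
          case (insert t J)
          then show ?case using k
            by (auto simp: cinfinite_def intro!: card_of_Un_ordLess_infinite_Field)
        qed
        moreover have "|F t| <o \<kappa>" if "t \<in> {t. t \<subset> s}" for t
          using Ft that by (simp add: P_less_def)
        ultimately show ?thesis by blast
      qed
    qed (use k finite_imp_ordLess_Cinfinite[OF psubset(1) k] in \<open>auto simp: cinfinite_def\<close>)
    ultimately have "s \<union> (\<Union>t\<in>{t. t \<subset> s}. F t) \<in> P_less \<kappa> X"
      using psubset(3) by (auto simp: P_less_def)
    then have "\<exists>y. y \<in> C \<and> s \<union> (\<Union>t\<in>{t. t \<subset> s}. F t) \<subseteq> y"
      using club_cofinal[OF C] by blast
    from someI_ex[OF this] show ?case using F[OF psubset(1)] unfolding H_def by simp
  qed
  then have "F t \<subseteq> F s" if "finite s" "s \<subseteq> X" "t \<subseteq> s" for s t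
    using that by (cases "t = s") blast+
  with main have "\<forall>s. finite s \<and> s \<subseteq> X \<longrightarrow> F s \<in> C \<and> s \<subseteq> F s \<and> (\<forall>t. t \<subseteq> s \<longrightarrow> F t \<subseteq> F s)"
    by simp
  then show ?thesis by (intro exI)
qed

text \<open>One union and no iteration, since the values \<open>F s\<close> will themselves lie in
  the club. Being finitary, the hull commutes with unions of chains, so hulls of limits are computed
  stage by stage.\<close>

definition fin_hull :: "('a set \<Rightarrow> 'b set) \<Rightarrow> 'a set \<Rightarrow> 'b set" where
  "fin_hull F y = (\<Union>s\<in>{s. finite s \<and> s \<subseteq> y}. F s)"

lemma fin_hull_mono: "y \<subseteq> y' \<Longrightarrow> fin_hull F y \<subseteq> fin_hull F y'"
  unfolding fin_hull_def by blast

lemma fin_hull_Union_chain: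
  assumes "I \<noteq> {}" "\<And>i j. i \<in> I \<Longrightarrow> j \<in> I \<Longrightarrow> f i \<subseteq> f j \<or> f j \<subseteq> f i"
  shows "fin_hull F (\<Union>i\<in>I. f i) = (\<Union>i\<in>I. fin_hull F (f i))"
proof
  show "fin_hull F (\<Union>i\<in>I. f i) \<subseteq> (\<Union>i\<in>I. fin_hull F (f i))"
  proof
    fix a assume "a \<in> fin_hull F (\<Union>i\<in>I. f i)"
    then obtain s where s: "finite s" "s \<subseteq> (\<Union>i\<in>I. f i)" "a \<in> F s" unfolding fin_hull_def by blast
    obtain i where "i \<in> I" "s \<subseteq> f i"
      using finite_subset_chain_UN[OF s(1) assms(1) s(2) assms(2)] by blast
    with s show "a \<in> (\<Union>i\<in>I. fin_hull F (f i))" unfolding fin_hull_def by blast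
  qed
  show "(\<Union>i\<in>I. fin_hull F (f i)) \<subseteq> fin_hull F (\<Union>i\<in>I. f i)"
    by (intro UN_least fin_hull_mono) blast
qed

text \<open>Induction on \<open>|y|\<close>: an infinite \<open>y\<close> is the union of its proper initial segments, which have
  smaller cardinality.\<close>

lemma club_fin_hull:
  assumes k: "Cinfinite \<kappa>" and C: "club \<kappa> X C"
  shows "\<exists>F. \<forall>y \<in> P_less \<kappa> X. fin_hull F y \<in> C \<and> y \<subseteq> fin_hull F y"
proof -
  obtain F where F0: "\<forall>s. finite s \<and> s \<subseteq> X \<longrightarrow> F s \<in> C \<and> s \<subseteq> F s \<and> (\<forall>t. t \<subseteq> s \<longrightarrow> F t \<subseteq> F s)"
    using club_monotone_selection[OF k C] by (rule exE)
  have F: "F s \<in> C" "s \<subseteq> F s" "t \<subseteq> s \<Longrightarrow> F t \<subseteq> F s" if "finite s" "s \<subseteq> X" for s t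
    using F0 that by simp_all
  have "fin_hull F y \<in> C" if "y \<in> P_less \<kappa> X" for y
    using that
  proof (induction y rule: wf_induct[OF wf_inv_image[OF wf_ordLess, of card_of]])
    case (1 y)
    then have IH: "\<And>w. |w| <o |y| \<Longrightarrow> w \<in> P_less \<kappa> X \<Longrightarrow> fin_hull F w \<in> C"
      and y: "y \<subseteq> X" "|y| <o \<kappa>"
      by (simp_all add: inv_image_def P_less_def)
    show ?case
    proof (cases "finite y")
      case True
      then have "fin_hull F y = F y"
        using F(3)[OF True y(1)] unfolding fin_hull_def by blast
      then show ?thesis using F(1)[OF True y(1)] by simp
    next
      case False
      let ?r = "|y|"
      have r: "Card_order ?r" "Field ?r = y" "Well_order ?r"
        by (rule card_of_Card_order, rule Field_card_of, rule card_of_Well_order)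
      have sub: "underS ?r i \<subseteq> y" for i
        using underS_Field[of _ ?r i] r(2) by blast
      have un: "(\<Union>i\<in>y. underS ?r i) = y"
      proof
        show "(\<Union>i\<in>y. underS ?r i) \<subseteq> y" using sub by blast
        \<comment> \<open>An infinite cardinal order has no last element.\<close>
        show "y \<subseteq> (\<Union>i\<in>y. underS ?r i)"
          using infinite_Card_order_limit[OF r(1)] False unfolding r(2) underS_def by blast
      qed
      have mono: "underS ?r i \<subseteq> underS ?r j" if "(i, j) \<in> ?r" for i j
        using that r(3) unfolding well_order_on_def linear_order_on_def partial_order_on_def
          preorder_on_def by (intro underS_incr) auto
      have tot: "underS ?r i \<subseteq> underS ?r j \<or> underS ?r j \<subseteq> underS ?r i" if "i \<in> y" "j \<in> y" for i j
      proof (cases "i = j")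
        case False
        then have "(i, j) \<in> ?r \<or> (j, i) \<in> ?r"
          using that r(2,3) unfolding well_order_on_def linear_order_on_def total_on_def by auto
        then show ?thesis using mono by blast
      qed auto
      have "fin_hull F (underS ?r i) \<in> C" if "i \<in> y" for i
      proof (rule IH)
        show *: "|underS ?r i| <o |y|" using card_of_underS[OF r(1)] that r(2) by simp
        have "underS ?r i \<subseteq> X" using sub y(1) by (rule subset_trans)
        then show "underS ?r i \<in> P_less \<kappa> X"
          using ordLess_transitive[OF * y(2)] by (simp add: P_less_def)
      qed
      then have "(\<Union>i\<in>Field ?r. fin_hull F (underS ?r i)) \<in> C"
      proof (intro club_Union_chain[OF C _ r(3) y(2)])
        show "Well_order \<kappa>" using k by (simp add: card_order_on_def)
      qed (use False r(2) in \<open>auto intro: fin_hull_mono[OF mono, THEN subsetD]\<close>)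
      then show ?thesis
        using fin_hull_Union_chain[of y "underS ?r" F, OF _ tot] False un r(2)
        by (metis finite.emptyI)
    qed
  qed
  moreover have "y \<subseteq> fin_hull F y" if "y \<in> P_less \<kappa> X" for y
  proof
    fix a assume a: "a \<in> y"
    then have "a \<in> F {a}" using that F(2)[of "{a}"] by (auto simp: P_less_def)
    then show "a \<in> fin_hull F y" using a unfolding fin_hull_def by blast
  qed
  ultimately show ?thesis by blast
qed

subsection \<open>Nonreflection\<close>

text \<open>The hypotheses in the form used: \<open>E\<close> and \<open>e\<close> are fixed once,
  regularity becomes \<open>stable\<close>, and covering is stated for sets of size at most
  \<open>\<mu>\<close>.\<close>

locale covering_setting =
  fixes \<nu> :: "'n rel" and \<kappa> :: "'k rel" and \<mu> \<Lambda> :: "'a rel"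
    and c :: "'a \<Rightarrow> 'a set" and T :: "'a set set"
    and E :: "'a \<Rightarrow> 'a set" and e :: "'a set \<Rightarrow> 'a \<Rightarrow> 'a"
  assumes nu: "Card_order \<nu>" "stable \<nu>" "natLeq <o \<nu>" "\<nu> <o \<kappa>"
    and kappa: "Card_order \<kappa>" "stable \<kappa>" "\<kappa> \<le>o \<mu>"
    and mu: "Card_order \<mu>" "\<mu> <o \<Lambda>" "Field \<mu> \<subseteq> Field \<Lambda>"
    and Lambda: "Card_order \<Lambda>"
    and E_subset: "\<And>\<alpha>. \<alpha> \<in> Field \<Lambda> \<Longrightarrow> E \<alpha> \<subseteq> Field \<Lambda>"
    and card_E: "\<And>\<alpha>. \<alpha> \<in> Field \<Lambda> \<Longrightarrow> |E \<alpha>| \<le>o \<mu>"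
    and cov: "\<And>G. G \<subseteq> Field \<Lambda> \<Longrightarrow> |G| \<le>o \<mu> \<Longrightarrow> \<exists>a\<in>P_less \<nu> (Field \<Lambda>). G \<subseteq> (\<Union>\<alpha>\<in>a. E \<alpha>)"
    and T_stationary: "stationary \<kappa> (Field \<mu>) T" and card_T: "|T| \<le>o \<mu>"
    and c_unbounded: "\<And>z. z \<in> T \<Longrightarrow> unbounded_in \<nu> z {c \<xi> | \<xi>. \<xi> \<in> z}"
    and e_onto: "\<And>B. |B| \<le>o \<mu> \<Longrightarrow> B \<subseteq> e B ` Field \<mu>"
begin

abbreviation "M \<equiv> Field \<mu>"
abbreviation "L \<equiv> Field \<Lambda>"

definition EU :: "'a set \<Rightarrow> 'a set" where
  "EU b = (\<Union>\<alpha>\<in>b. E \<alpha>)"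

definition E_closed :: "'a set \<Rightarrow> bool" where
  "E_closed B \<longleftrightarrow> (\<forall>\<gamma>\<in>B. E \<gamma> \<subseteq> B)"

definition diagonal_family :: "'a set set" where
  "diagonal_family = {x \<in> P_less \<kappa> L. x \<inter> M \<in> T \<and>
         (\<exists>b\<in>P_less \<nu> x. E_closed (EU b) \<and> x \<subseteq> EU b \<and> \<not> x \<subseteq> e (EU b) ` (x \<inter> M))}"

lemma natLeq_kappa: "natLeq <o \<kappa>"
  using nu(3,4) by (rule ordLess_transitive)

lemma infinite_nu: "\<not> finite (Field \<nu>)"
  using cinfinite_mono[OF ordLess_imp_ordLeq[OF nu(3)] natLeq_cinfinite] by (simp add: cinfinite_def)

lemma infinite_kappa: "\<not> finite (Field \<kappa>)"
  using cinfinite_mono[OF ordLess_imp_ordLeq[OF natLeq_kappa] natLeq_cinfinite]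
  by (simp add: cinfinite_def)

lemma natLeq_mu: "natLeq \<le>o \<mu>"
  using ordLess_ordLeq_trans[OF natLeq_kappa kappa(3)] by (rule ordLess_imp_ordLeq)

lemma infinite_mu: "\<not> finite M"
  using cinfinite_mono[OF natLeq_mu natLeq_cinfinite] by (simp add: cinfinite_def)

lemma nu_le_mu: "\<nu> \<le>o \<mu>"
  using ordLess_ordLeq_trans[OF nu(4) kappa(3)] by (rule ordLess_imp_ordLeq)

lemma card_UN_le_mu:
  "|I| \<le>o \<mu> \<Longrightarrow> (\<And>i. i \<in> I \<Longrightarrow> |A i| \<le>o \<mu>) \<Longrightarrow> |\<Union>i\<in>I. A i| \<le>o \<mu>"
  using card_of_UNION_ordLeq_infinite_Field[OF infinite_mu mu(1)] by blast

lemma card_Un_le_mu: "|A| \<le>o \<mu> \<Longrightarrow> |B| \<le>o \<mu> \<Longrightarrow> |A \<union> B| \<le>o \<mu>"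
  using card_of_Un_ordLeq_infinite_Field[OF infinite_mu _ _ mu(1)] by blast

lemma card_M: "|M| \<le>o \<mu>"
  using card_of_Field_ordIso[OF mu(1)] by (rule ordIso_imp_ordLeq)

lemma P_nu_card_le_mu: "b \<in> P_less \<nu> X \<Longrightarrow> |b| \<le>o \<mu>"
  unfolding P_less_def using ordLess_ordLeq_trans[OF _ nu_le_mu, THEN ordLess_imp_ordLeq] by blast

lemma P_kappa_card_le_mu: "x \<in> P_less \<kappa> X \<Longrightarrow> |x| \<le>o \<mu>"
  unfolding P_less_def using ordLess_ordLeq_trans[OF _ kappa(3), THEN ordLess_imp_ordLeq] by blast

lemma P_nu_imp_P_kappa: "b \<in> P_less \<nu> X \<Longrightarrow> b \<in> P_less \<kappa> X"
  unfolding P_less_def using ordLess_transitive[OF _ nu(4)] by blast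

lemma EU_mono: "b \<subseteq> b' \<Longrightarrow> EU b \<subseteq> EU b'"
  unfolding EU_def by blast

lemma EU_subset_closed: "E_closed B \<Longrightarrow> b \<subseteq> B \<Longrightarrow> EU b \<subseteq> B"
  unfolding EU_def E_closed_def by blast

lemma EU_subset_L: "b \<subseteq> L \<Longrightarrow> EU b \<subseteq> L"
  unfolding EU_def using E_subset by blast

lemma card_EU: "b \<subseteq> L \<Longrightarrow> |b| \<le>o \<mu> \<Longrightarrow> |EU b| \<le>o \<mu>"
  unfolding EU_def using card_E by (intro card_UN_le_mu) blast+

lemma diagonal_family_nonreflecting:
  assumes MA: "M \<subseteq> A" and AL: "A \<subseteq> L" and card_A: "|A| =o \<mu>"
  shows "\<not> stationary \<kappa> A (diagonal_family \<inter> P_less \<kappa> A)"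
proof
  assume st: "stationary \<kappa> A (diagonal_family \<inter> P_less \<kappa> A)"
  have "|M| =o |A|"
    using ordIso_transitive[OF card_of_Field_ordIso[OF mu(1)] ordIso_symmetric[OF card_A]] .
  then obtain m where m: "bij_betw m M A" using card_of_ordIso by blast
  define m' where "m' = inv_into M m"
  have m': "m' \<gamma> \<in> M" "m (m' \<gamma>) = \<gamma>" if "\<gamma> \<in> A" for \<gamma>
    using that m unfolding m'_def bij_betw_def by (auto intro: inv_into_into f_inv_into_f)
  have mA: "m \<xi> \<in> A" if "\<xi> \<in> M" for \<xi> using m that by (auto simp: bij_betw_def)
  \<comment> \<open>\<open>w \<xi>\<close> witnesses, where possible, that the set given by
    \<open>\<xi>\<close> does not cover \<open>A\<close>; otherwise it is any element of
    \<open>A\<close>. Closing \<open>x\<close> under \<open>w\<close> turns a cover of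
    \<open>x\<close> into a cover of \<open>A\<close>.\<close>
  have "\<forall>\<xi>. \<exists>w\<in>A. A \<subseteq> EU (m ` c \<xi>) \<or> w \<notin> EU (m ` c \<xi>)"
  proof
    fix \<xi>
    have "A \<noteq> {}" using MA infinite_mu by auto
    then show "\<exists>w\<in>A. A \<subseteq> EU (m ` c \<xi>) \<or> w \<notin> EU (m ` c \<xi>)" by blast
  qed
  then obtain w where w: "\<And>\<xi>. w \<xi> \<in> A" "\<And>\<xi>. A \<subseteq> EU (m ` c \<xi>) \<or> w \<xi> \<notin> EU (m ` c \<xi>)"
    by metis
  \<comment> \<open>Candidates for the sets \<open>EU b\<close> found below. Being generated from
    inside \<open>A\<close>, each lies in every \<open>E\<close>-closed superset of
    \<open>A\<close>; so there is at most one, fixed before \<open>x\<close> is chosen.\<close>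
  define hull where "hull B \<longleftrightarrow> (\<exists>d. d \<subseteq> A \<and> B = EU d) \<and> E_closed B \<and> A \<subseteq> B \<and> |B| \<le>o \<mu>" for B
  have hull_least: "B \<subseteq> B'" if B: "hull B" "hull B'" for B B'
  proof -
    obtain d where "d \<subseteq> A" "B = EU d" using B(1) unfolding hull_def by blast
    moreover have "A \<subseteq> B'" "E_closed B'" using B(2) unfolding hull_def by simp_all
    ultimately show ?thesis using EU_subset_closed[of B' d] by simp
  qed
  have hull_unique: "B = B'" if "hull B" "hull B'" for B B'
    using hull_least that by (intro equalityI)
  \<comment> \<open>\<open>h\<close> inverts \<open>e B\<close> on \<open>A\<close> for the only
    possible hull \<open>B\<close>; if there is none, \<open>m'\<close> is the default.\<close>
  have "\<exists>h. \<forall>\<gamma>\<in>A. h \<gamma> \<in> M \<and> (\<forall>B. hull B \<longrightarrow> e B (h \<gamma>) = \<gamma>)"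
  proof (cases "\<exists>B. hull B")
    case True
    then obtain B where B: "hull B" by blast
    then have "A \<subseteq> e B ` M" using e_onto unfolding hull_def by blast
    then have "\<forall>\<gamma>\<in>A. \<exists>\<xi>\<in>M. e B \<xi> = \<gamma>" by blast
    then obtain h where "\<forall>\<gamma>\<in>A. h \<gamma> \<in> M \<and> e B (h \<gamma>) = \<gamma>" by metis
    then show ?thesis using hull_unique[OF B] by blast
  next
    case False
    then show ?thesis using m'(1) by blast
  qed
  then obtain h where h: "\<And>\<gamma>. \<gamma> \<in> A \<Longrightarrow> h \<gamma> \<in> M" "\<And>\<gamma> B. \<gamma> \<in> A \<Longrightarrow> hull B \<Longrightarrow> e B (h \<gamma>) = \<gamma>"
    by blast
  define K where "K s = m ` (s \<inter> M) \<union> m' ` s \<union> w ` s \<union> h ` s" for s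
  have "K s \<in> P_less \<kappa> A" if s: "finite s" "s \<subseteq> A" for s
  proof (intro P_less_finite natLeq_kappa)
    show "finite (K s)" using s(1) by (simp add: K_def)
    have "m ` (s \<inter> M) \<subseteq> A" "m' ` s \<subseteq> A" "w ` s \<subseteq> A" "h ` s \<subseteq> A"
      using mA subsetD[OF MA m'(1)] w(1) subsetD[OF MA h(1)] subsetD[OF s(2)] by auto
    then show "K s \<subseteq> A" by (simp add: K_def)
  qed
  from stationary_closure_point[where K = K, OF kappa(1,2) natLeq_kappa st this]
  obtain x where x: "x \<in> diagonal_family" "x \<in> P_less \<kappa> A" and cl: "\<And>s. finite s \<Longrightarrow> s \<subseteq> x \<Longrightarrow> K s \<subseteq> x"
    by auto
  have xA: "x \<subseteq> A" using x(2) by (simp add: P_less_def)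
  define z where "z = x \<inter> M"
  have K: "m \<xi> \<in> x" "w \<xi> \<in> x" if "\<xi> \<in> z" for \<xi>
    using cl[of "{\<xi>}"] that by (auto simp: K_def z_def)
  have K': "m' \<gamma> \<in> z" "h \<gamma> \<in> z" if "\<gamma> \<in> x" for \<gamma>
    using cl[of "{\<gamma>}"] that xA m'(1) h(1) by (auto simp: K_def z_def)
  obtain b where zT: "z \<in> T" and b: "b \<subseteq> x" "|b| <o \<nu>" "E_closed (EU b)" "x \<subseteq> EU b"
      "\<not> x \<subseteq> e (EU b) ` z"
  proof -
    have "z \<in> T \<and> (\<exists>b\<in>P_less \<nu> x. E_closed (EU b) \<and> x \<subseteq> EU b \<and> \<not> x \<subseteq> e (EU b) ` z)"
      using x(1) unfolding diagonal_family_def z_def by simp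
    then show ?thesis using that unfolding P_less_def by auto
  qed
  have "m' ` b \<in> P_less \<nu> z"
    using b(1,2) K'(1) ordLeq_ordLess_trans[OF card_of_image b(2)] by (auto simp: P_less_def)
  then obtain \<xi> where xi: "\<xi> \<in> z" "m' ` b \<subseteq> c \<xi>" "c \<xi> \<subseteq> z"
  proof -
    have "\<exists>y\<in>{c \<xi> | \<xi>. \<xi> \<in> z}. m' ` b \<subseteq> y" "{c \<xi> | \<xi>. \<xi> \<in> z} \<subseteq> P_less \<nu> z"
      using c_unbounded[OF zT] \<open>m' ` b \<in> P_less \<nu> z\<close> unfolding unbounded_in_def by simp_all
    then show ?thesis using that by (auto simp: P_less_def)
  qed
  \<comment> \<open>\<open>d\<close> replaces the unknown \<open>b\<close> by a set determined by
    \<open>\<xi>\<close>. As \<open>b \<subseteq> d \<subseteq> x \<subseteq> EU b\<close> and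
    \<open>EU b\<close> is closed, both generate the same set.\<close>
  define d where "d = m ` c \<xi>"
  have dx: "d \<subseteq> x" using xi(3) K(1) by (auto simp: d_def)
  have bd: "b \<subseteq> d"
  proof
    fix \<gamma> assume g: "\<gamma> \<in> b"
    then have "m (m' \<gamma>) = \<gamma>" using m'(2) b(1) xA by blast
    then show "\<gamma> \<in> d" using xi(2) g unfolding d_def by (metis image_eqI image_subset_iff)
  qed
  have eq: "EU b = EU d"
    using EU_mono[OF bd] EU_subset_closed[OF b(3), of d] dx b(4) by blast
  have "w \<xi> \<in> EU d" using K(2)[OF xi(1)] b(4) eq by blast
  then have "A \<subseteq> EU b" using w(2)[of \<xi>] eq by (simp add: d_def)
  moreover have "|EU b| \<le>o \<mu>"
    using b(1,2) xA AL P_nu_card_le_mu[of b L] by (intro card_EU) (auto simp: P_less_def)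
  ultimately have hb: "hull (EU b)"
    using b(1,3) xA unfolding hull_def by (intro conjI exI[of _ b]) auto
  have "x \<subseteq> e (EU b) ` z"
  proof
    fix \<gamma> assume g: "\<gamma> \<in> x"
    have "e (EU b) (h \<gamma>) = \<gamma>" using h(2)[OF subsetD[OF xA g] hb] .
    then show "\<gamma> \<in> e (EU b) ` z" using K'(2)[OF g] by (metis image_eqI)
  qed
  with b(5) show False by contradiction
qed

subsection \<open>Stationarity\<close>

definition small :: "'a set \<Rightarrow> bool" where
  "small G \<longleftrightarrow> G \<subseteq> L \<and> |G| \<le>o \<mu>"

lemma small_Un: "small A \<Longrightarrow> small B \<Longrightarrow> small (A \<union> B)"
  unfolding small_def by (simp add: card_Un_le_mu)

lemma small_UN: "|I| \<le>o \<mu> \<Longrightarrow> (\<And>i. i \<in> I \<Longrightarrow> small (A i)) \<Longrightarrow> small (\<Union>i\<in>I. A i)"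
  using card_UN_le_mu[of I A] unfolding small_def by (simp add: UN_least)

lemma small_M: "small M"
  using mu(3) card_M by (simp add: small_def)

lemma small_EU: "small b \<Longrightarrow> small (EU b)"
  using EU_subset_L card_EU unfolding small_def by simp

text \<open>
  The opponent moves \<open>G\<close> at the position \<open>b\<close>, and \<open>b'\<close> is a legal answer. The clause \<open>\<not> b' \<subseteq> G\<close> ensures
  that the unbeaten positions have a union of size greater than \<open>\<mu>\<close>.
\<close>

definition legal :: "('a set \<Rightarrow> 'a set) \<Rightarrow> 'a set \<Rightarrow> 'a set \<Rightarrow> 'a set \<Rightarrow> 'a set \<Rightarrow> bool" where
  "legal U z b G b' \<longleftrightarrow>
     b' \<in> P_less \<nu> L \<and> b \<subseteq> b' \<and> G \<subseteq> EU b' \<and> \<not> b' \<subseteq> G \<and> U (z \<union> b') \<inter> M \<subseteq> z"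

text \<open>
  A strategy of the opponent sees the answers \<open>f 1, \<dots>, f n\<close> but not the initial position \<open>f 0\<close>, so
  that strategies against the possible first answers combine into one strategy.
\<close>

definition play :: "('a set \<Rightarrow> 'a set) \<Rightarrow> 'a set \<Rightarrow> ('a set list \<Rightarrow> 'a set) \<Rightarrow> (nat \<Rightarrow> 'a set) \<Rightarrow> bool" where
  "play U z \<sigma> f \<longleftrightarrow> (\<forall>n. legal U z (f n) (\<sigma> (map f [1..<Suc n])) (f (Suc n)))"

text \<open>The absence of a winning strategy for the opponent. No strategy for the other player is
  claimed; \<open>unbeaten_step\<close> supplies answers one at a time.\<close>

definition unbeaten :: "('a set \<Rightarrow> 'a set) \<Rightarrow> 'a set \<Rightarrow> 'a set \<Rightarrow> bool" where
  "unbeaten U z b \<longleftrightarrow> (\<forall>\<sigma>. (\<forall>h. small (\<sigma> h)) \<longrightarrow> (\<exists>f. f 0 = b \<and> play U z \<sigma> f))"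

text \<open>If every legal answer to \<open>G\<close> were beaten by some strategy, playing
  \<open>G\<close> first and then the strategy against the answer received would beat
  \<open>b\<close>.\<close>

lemma unbeaten_step:
  assumes b: "unbeaten U z b" and G: "small G"
  shows "\<exists>b'. legal U z b G b' \<and> unbeaten U z b'"
proof (rule ccontr)
  assume no: "\<not> ?thesis"
  have "\<exists>\<sigma>. (\<forall>h. small (\<sigma> h)) \<and> (legal U z b G b' \<longrightarrow> \<not> (\<exists>f. f 0 = b' \<and> play U z \<sigma> f))" for b'
  proof (cases "legal U z b G b'")
    case True
    then have "\<not> unbeaten U z b'" using no by blast
    then show ?thesis unfolding unbeaten_def by auto
  next
    case False
    then show ?thesis using G by (intro exI[of _ "\<lambda>_. G"]) simp
  qed
  then obtain \<tau> where t: "\<And>b' h. small (\<tau> b' h)"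
      "\<And>b' f. legal U z b G b' \<Longrightarrow> f 0 = b' \<Longrightarrow> \<not> play U z (\<tau> b') f"
    by metis
  \<comment> \<open>The first entry of the history is the first answer and selects the strategy to
    follow. That strategy sees only the rest, because \<open>b'\<close> is its initial
    position.\<close>
  define \<sigma> where "\<sigma> h = (case h of [] \<Rightarrow> G | b' # h' \<Rightarrow> \<tau> b' h')" for h
  have "\<forall>h. small (\<sigma> h)" using t(1) G by (auto simp: \<sigma>_def split: list.split)
  then obtain f where f: "f 0 = b" "play U z \<sigma> f" using b unfolding unbeaten_def by blast
  define g where "g n = f (Suc n)" for n
  have "legal U z b G (f 1)"
    using f(2)[unfolded play_def, rule_format, of 0] f(1) by (simp add: \<sigma>_def)
  moreover have "play U z (\<tau> (f 1)) g"
    unfolding play_def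
  proof
    fix n
    have "map f [1..<Suc (Suc n)] = f 1 # map g [1..<Suc n]"
      by (simp add: upt_conv_Cons g_def flip: map_Suc_upt del: upt_Suc)
    then show "legal U z (g n) (\<tau> (f 1) (map g [1..<Suc n])) (g (Suc n))"
      using f(2)[unfolded play_def, rule_format, of "Suc n"] by (simp add: \<sigma>_def g_def del: upt_Suc)
  qed
  ultimately show False using t(2)[of "f 1" g] by (simp add: g_def)
qed

text \<open>Covering yields \<open>a\<close>; since \<open>|G| \<le>o \<mu>\<close> and
  \<open>\<mu> <o \<Lambda>\<close>, a point \<open>p\<close> outside \<open>G\<close> can be added
  to secure \<open>\<not> b' \<subseteq> G\<close>.\<close>

lemma small_extension:
  assumes b: "b \<in> P_less \<nu> L" and G: "small G"
  shows "\<exists>b'\<in>P_less \<nu> L. b \<subseteq> b' \<and> G \<subseteq> EU b' \<and> \<not> b' \<subseteq> G"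
proof -
  obtain a where a: "a \<in> P_less \<nu> L" "G \<subseteq> EU a"
    using cov[of G] G unfolding small_def EU_def by blast
  have "\<not> L \<subseteq> G"
  proof
    assume "L \<subseteq> G"
    then have "|L| \<le>o \<mu>" using G ordLeq_transitive[OF card_of_mono1] unfolding small_def by blast
    then have "\<Lambda> \<le>o \<mu>"
      using ordIso_ordLeq_trans[OF ordIso_symmetric[OF card_of_Field_ordIso[OF Lambda]]] by blast
    then show False using mu(2) not_ordLess_ordLeq by blast
  qed
  then obtain p where p: "p \<in> L" "p \<notin> G" by blast
  have "{p} \<in> P_less \<nu> L" using p by (intro P_less_finite nu) auto
  then have "b \<union> a \<union> {p} \<in> P_less \<nu> L" using a b by (intro P_less_Un infinite_nu nu)
  moreover have "G \<subseteq> EU (b \<union> a \<union> {p})" using a(2) EU_mono[of a "b \<union> a \<union> {p}"] by blast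
  ultimately show ?thesis using p(2) by (intro bexI[of _ "b \<union> a \<union> {p}"]) auto
qed

text \<open>If the opponent won for every \<open>z \<in> T\<close>, one could play against all the \<open>|T| \<le> \<mu>\<close> winning
  strategies at once; a club of \<open>z\<close> survives the resulting play.\<close>

lemma ex_unbeaten:
  assumes F: "\<And>y. y \<in> P_less \<kappa> L \<Longrightarrow> fin_hull F y \<in> P_less \<kappa> L"
  shows "\<exists>z\<in>T. unbeaten (fin_hull F) z {}"
proof (rule ccontr)
  let ?U = "fin_hull F"
  assume "\<not> ?thesis"
  then have "\<forall>z\<in>T. \<exists>\<sigma>. (\<forall>h. small (\<sigma> h)) \<and> \<not> (\<exists>f. f 0 = {} \<and> play ?U z \<sigma> f)"
    unfolding unbeaten_def by blast
  then obtain \<sigma> where s: "\<And>z h. z \<in> T \<Longrightarrow> small (\<sigma> z h)"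
      "\<And>z f. z \<in> T \<Longrightarrow> f 0 = {} \<Longrightarrow> \<not> play ?U z (\<sigma> z) f"
    by metis
  \<comment> \<open>One move containing the moves of all the strategies at the same history.\<close>
  define G where "G h = (\<Union>z\<in>T. \<sigma> z h)" for h
  have G: "small (G h)" for h
    unfolding G_def using s(1) by (intro small_UN card_T)
  define good where "good h b \<longleftrightarrow> b \<in> P_less \<nu> L \<and> \<Union>(set h) \<subseteq> b \<and> G h \<subseteq> EU b \<and> \<not> b \<subseteq> G h" for h b
  define R where "R h = (SOME b. good h b)" for h
  have R: "good h (R h)" if "\<Union>(set h) \<in> P_less \<nu> L" for h
  proof -
    have "\<exists>b. good h b" using small_extension[OF that G[of h]] unfolding good_def by (elim bexE) auto
    then show ?thesis unfolding R_def by (rule someI_ex)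
  qed
  define hs where "hs = rec_nat [] (\<lambda>_ h. h @ [R h])"
  have hs: "hs 0 = []" "hs (Suc n) = hs n @ [R (hs n)]" for n by (simp_all add: hs_def)
  have hsP: "\<Union>(set (hs n)) \<in> P_less \<nu> L" for n
  proof (induction n)
    case 0
    then show ?case using P_less_finite[OF nu(3), of "{}"] by (simp add: hs)
  next
    case (Suc n)
    then show ?case using R[OF Suc] by (simp add: hs good_def P_less_Un infinite_nu nu(1))
  qed
  \<comment> \<open>The initial position \<open>{}\<close> is not part of the history:
    \<open>hs n\<close> lists \<open>f 1\<close> up to \<open>f n\<close>.\<close>
  define f where "f n = (case n of 0 \<Rightarrow> {} | Suc k \<Rightarrow> R (hs k))" for n
  have map_f: "map f [1..<Suc n] = hs n" for n
    by (induction n) (simp_all add: hs f_def)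
  have fS: "good (hs n) (f (Suc n))" for n using R[OF hsP] by (simp add: f_def)
  have fP: "f n \<in> P_less \<nu> L" for n
    using fS P_less_finite[OF nu(3), of "{}"] by (cases n) (auto simp: good_def f_def)
  have "f n \<subseteq> \<Union>(set (hs n))" for n by (cases n) (auto simp: f_def hs)
  then have f_Suc: "f n \<subseteq> f (Suc n)" for n using fS unfolding good_def by blast
  define b where "b = (\<Union>n. f n)"
  have bP: "b \<in> P_less \<nu> L" unfolding b_def by (intro P_less_countable_UN nu fP)
  \<comment> \<open>A \<open>z\<close> in \<open>T\<close> closed under these traces keeps the hull
    of \<open>z \<union> b\<close>, and so of \<open>z\<close> with any position of the play, within
    \<open>z\<close> on \<open>M\<close>.\<close>
  define K where "K s = ?U (s \<union> b) \<inter> M" for s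
  have "K s \<in> P_less \<kappa> M" if "finite s" "s \<subseteq> M" for s
  proof -
    have "s \<in> P_less \<kappa> L" using that mu(3) by (intro P_less_finite natLeq_kappa) auto
    then have "?U (s \<union> b) \<in> P_less \<kappa> L"
      using F P_less_Un[OF infinite_kappa kappa(1) _ P_nu_imp_P_kappa[OF bP]] by blast
    then have "K s \<in> P_less \<kappa> L" using P_less_subset unfolding K_def by blast
    then show ?thesis by (simp add: P_less_def K_def)
  qed
  from stationary_closure_point[where K = K, OF kappa(1,2) natLeq_kappa T_stationary this]
  obtain z where z: "z \<in> T" and cl: "\<And>s. finite s \<Longrightarrow> s \<subseteq> z \<Longrightarrow> K s \<subseteq> z"
    by auto
  have zb: "?U (z \<union> b) \<inter> M \<subseteq> z"
  proof
    fix a assume "a \<in> ?U (z \<union> b) \<inter> M"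
    then obtain s where "finite s" "s \<subseteq> z \<union> b" "a \<in> F s" "a \<in> M" unfolding fin_hull_def by blast
    then have "a \<in> K (s \<inter> z)" unfolding K_def fin_hull_def by blast
    then show "a \<in> z" using cl[of "s \<inter> z"] \<open>finite s\<close> by blast
  qed
  have "play ?U z (\<sigma> z) f"
    unfolding play_def
  proof
    fix n
    have "?U (z \<union> f (Suc n)) \<subseteq> ?U (z \<union> b)" unfolding b_def by (intro fin_hull_mono) blast
    then have "?U (z \<union> f (Suc n)) \<inter> M \<subseteq> z" using zb by blast
    moreover have "\<sigma> z (hs n) \<subseteq> G (hs n)" using z unfolding G_def by blast
    ultimately show "legal ?U z (f n) (\<sigma> z (map f [1..<Suc n])) (f (Suc n))"
      using fS[of n] f_Suc[of n] unfolding map_f legal_def good_def by blast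
  qed
  then show False using s(2)[OF z, of f] by (simp add: f_def)
qed

section \<open>Interleaving many plays\<close>

lemma diagonal_family_meets_club:
  assumes C: "club \<kappa> L C"
  shows "diagonal_family \<inter> C \<noteq> {}"
proof -
  have "Cinfinite \<kappa>" using infinite_kappa kappa(1) by (simp add: cinfinite_def)
  then obtain F where F: "\<And>y. y \<in> P_less \<kappa> L \<Longrightarrow> fin_hull F y \<in> C"
      "\<And>y. y \<in> P_less \<kappa> L \<Longrightarrow> y \<subseteq> fin_hull F y"
    using club_fin_hull[OF _ C] by blast
  define U where "U = fin_hull F"
  have UP: "U y \<in> P_less \<kappa> L" if "y \<in> P_less \<kappa> L" for y
    using F(1)[OF that] club_imp_P_less[OF C] by (simp add: U_def)
  obtain z where zT: "z \<in> T" and z: "unbeaten U z {}"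
    using ex_unbeaten[of F] UP unfolding U_def by blast
  have zM: "z \<in> P_less \<kappa> M" using T_stationary zT unfolding stationary_def by blast
  then have zP: "z \<in> P_less \<kappa> L" using mu(3) by (rule P_less_mono)
  have zbP: "z \<union> b \<in> P_less \<kappa> L" if "b \<in> P_less \<nu> L" for b
    using P_less_Un[OF infinite_kappa kappa(1) zP P_nu_imp_P_kappa[OF that]] .

  \<comment> \<open>Were \<open>W\<close> small, the opponent could play it, and the unbeaten answer
    would be a part of \<open>W\<close> not contained in \<open>W\<close>. So \<open>W\<close> is
    large enough to contain an index set \<open>I\<close> of size \<open>\<kappa>\<close>.\<close>
  define W where "W = \<Union>{b \<in> P_less \<nu> L. unbeaten U z b}"
  have "\<not> |W| \<le>o \<mu>"
  proof
    assume "|W| \<le>o \<mu>"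
    then have "small W" by (auto simp: small_def W_def P_less_def)
    from unbeaten_step[OF z this] show False unfolding legal_def W_def by blast
  qed
  then have "\<mu> \<le>o |W|"
    using ordLeq_total[of "|W|" \<mu>] mu(1) by (auto simp: card_order_on_def card_of_Well_order)
  then have "|Field \<kappa>| \<le>o |W|"
    using ordIso_ordLeq_trans[OF card_of_Field_ordIso[OF kappa(1)]] ordLeq_transitive[OF kappa(3)] by blast
  then obtain I where I: "I \<subseteq> W" "|Field \<kappa>| =o |I|" using internalize_card_of_ordLeq2 by blast
  have cI: "|I| =o \<kappa>"
    using ordIso_transitive[OF ordIso_symmetric[OF I(2)] card_of_Field_ordIso[OF kappa(1)]] .
  have I_mu: "|I| \<le>o \<mu>" using ordIso_ordLeq_trans[OF cI kappa(3)] .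
  have "I \<noteq> {}"
  proof
    assume "I = {}"
    then show False using I(2) infinite_kappa card_of_ordIso_finite[of "Field \<kappa>" I] by simp
  qed
  then obtain i0 where i0: "i0 \<in> I" by blast

  \<comment> \<open>The common move in all plays. It absorbs the hulls, to keep each
    \<open>x i\<close> inside \<open>A\<close>; the sets \<open>EU (\<beta> i)\<close>, to make all
    plays end with the same set; and \<open>EU (EU (\<beta> i))\<close>, to make that set
    closed.\<close>
  define G where "G \<beta> = M \<union> (\<Union>i\<in>I. U (z \<union> \<beta> i) \<union> EU (\<beta> i) \<union> EU (EU (\<beta> i)))" for \<beta> :: "'a \<Rightarrow> 'a set"
  have G: "small (G \<beta>)" if b: "\<And>i. i \<in> I \<Longrightarrow> \<beta> i \<in> P_less \<nu> L" for \<beta>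
  proof -
    have "small (U (z \<union> \<beta> i) \<union> EU (\<beta> i) \<union> EU (EU (\<beta> i)))" if i: "i \<in> I" for i
    proof -
      have "small (\<beta> i)" using b[OF i] P_nu_card_le_mu by (auto simp: small_def P_less_def)
      moreover have "small (U (z \<union> \<beta> i))"
        using UP[OF zbP[OF b[OF i]]] P_kappa_card_le_mu by (auto simp: small_def P_less_def)
      ultimately show ?thesis by (intro small_Un small_EU)
    qed
    from small_UN[OF I_mu this] show ?thesis unfolding G_def by (rule small_Un[OF small_M])
  qed

  \<comment> \<open>The clause at \<open>n = 0\<close> puts \<open>i\<close> into the play with
    index \<open>i\<close>, so the final hulls together contain \<open>I\<close>.\<close>
  let ?P = "\<lambda>n \<beta>. (\<forall>i\<in>I. \<beta> i \<in> P_less \<nu> L \<and> unbeaten U z (\<beta> i)) \<and> (n = (0::nat) \<longrightarrow> (\<forall>i\<in>I. i \<in> \<beta> i))"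
  let ?Q = "\<lambda>n \<beta> \<beta>'. \<forall>i\<in>I. legal U z (\<beta> i) (G \<beta>) (\<beta>' i)"
  have "\<exists>\<beta>. \<forall>n. ?P n (\<beta> n) \<and> ?Q n (\<beta> n) (\<beta> (Suc n))"
  proof (rule dependent_nat_choice)
    have "\<forall>i\<in>I. \<exists>b. b \<in> P_less \<nu> L \<and> unbeaten U z b \<and> i \<in> b" using I(1) unfolding W_def by blast
    from bchoice[OF this] show "\<exists>\<beta>. ?P 0 \<beta>" by blast
  next
    fix \<beta> n assume P: "?P n \<beta>"
    then have "small (G \<beta>)" by (intro G) blast
    then have "\<forall>i\<in>I. \<exists>b'. legal U z (\<beta> i) (G \<beta>) b' \<and> unbeaten U z b'"
      using P unbeaten_step by blast
    from bchoice[OF this] obtain \<beta>' where "\<forall>i\<in>I. legal U z (\<beta> i) (G \<beta>) (\<beta>' i) \<and> unbeaten U z (\<beta>' i)"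
      by blast
    then show "\<exists>\<beta>'. ?P (Suc n) \<beta>' \<and> ?Q n \<beta> \<beta>'" unfolding legal_def by blast
  qed
  then obtain \<beta> where beta: "\<And>n. ?P n (\<beta> n) \<and> ?Q n (\<beta> n) (\<beta> (Suc n))" by blast
  have bP: "\<beta> n i \<in> P_less \<nu> L" if "i \<in> I" for n i using beta[of n] that by blast
  have b0: "i \<in> \<beta> 0 i" if "i \<in> I" for i using beta[of 0] that by blast
  have leg: "legal U z (\<beta> n i) (G (\<beta> n)) (\<beta> (Suc n) i)" if "i \<in> I" for n i using beta[of n] that by blast
  have b_Suc: "\<beta> n i \<subseteq> \<beta> (Suc n) i" if "i \<in> I" for n i using leg[OF that] unfolding legal_def by blast
  have G_Suc: "G (\<beta> n) \<subseteq> EU (\<beta> (Suc n) i)" if "i \<in> I" for n i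
    using leg[OF that] unfolding legal_def by blast

  define A where "A = (\<Union>n. G (\<beta> n))"
  define b where "b i = (\<Union>n. \<beta> n i)" for i
  \<comment> \<open>For all \<open>i\<close> and \<open>j\<close> in \<open>I\<close>, \<open>EU
    (\<beta> n i) \<subseteq> G (\<beta> n) \<subseteq> EU (\<beta> (Suc n) j)\<close>.\<close>
  have A_eq: "EU (b i) = A" if i: "i \<in> I" for i
  proof
    have "EU (\<beta> n i) \<subseteq> G (\<beta> n)" for n using i unfolding G_def by blast
    then show "EU (b i) \<subseteq> A" unfolding A_def b_def EU_def by blast
    have "G (\<beta> n) \<subseteq> EU (b i)" for n
      by (rule subset_trans[OF G_Suc[OF i] EU_mono]) (auto simp: b_def)
    then show "A \<subseteq> EU (b i)" unfolding A_def by (intro UN_least)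
  qed
  have closed: "E_closed A"
    unfolding E_closed_def
  proof
    fix \<gamma> assume "\<gamma> \<in> A"
    then obtain n where "\<gamma> \<in> EU (\<beta> n i0)" using G_Suc[OF i0] unfolding A_def by blast
    then have "E \<gamma> \<subseteq> EU (EU (\<beta> n i0))" unfolding EU_def by blast
    then show "E \<gamma> \<subseteq> A" using i0 unfolding A_def G_def by blast
  qed
  have bnu: "b i \<in> P_less \<nu> L" if "i \<in> I" for i
    unfolding b_def using bP[OF that] by (intro P_less_countable_UN nu)
  define x where "x i = U (z \<union> b i)" for i
  have xC: "x i \<in> C" and zbx: "z \<union> b i \<subseteq> x i" and xP: "x i \<in> P_less \<kappa> L" if "i \<in> I" for i
    using F[OF zbP[OF bnu[OF that]]] UP[OF zbP[OF bnu[OF that]]] by (auto simp: x_def U_def)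
  have x_UN: "x i = (\<Union>n. U (z \<union> \<beta> n i))" if "i \<in> I" for i
  proof -
    have mono: "\<beta> m i \<subseteq> \<beta> n i" if "m \<le> n" for m n
      using lift_Suc_mono_le[of "\<lambda>n. \<beta> n i", OF b_Suc[OF \<open>i \<in> I\<close>] that] .
    have "z \<union> b i = (\<Union>n. z \<union> \<beta> n i)" unfolding b_def by blast
    moreover have "fin_hull F (\<Union>n. z \<union> \<beta> n i) = (\<Union>n. fin_hull F (z \<union> \<beta> n i))"
    proof (rule fin_hull_Union_chain)
      fix m n :: nat
      show "z \<union> \<beta> m i \<subseteq> z \<union> \<beta> n i \<or> z \<union> \<beta> n i \<subseteq> z \<union> \<beta> m i"
        using mono[of m n] mono[of n m] linear[of m n] by blast
    qed simp
    ultimately show ?thesis by (simp add: x_def U_def)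
  qed
  have xA: "x i \<subseteq> A" if "i \<in> I" for i
    using that unfolding x_UN[OF that] A_def G_def by blast
  have xM: "x i \<inter> M = z" if i: "i \<in> I" for i
  proof
    \<comment> \<open>Legality bounds the trace of answers only, not of the position at stage 0;
      stage \<open>n\<close> is therefore read off from stage \<open>Suc n\<close>.\<close>
    have "U (z \<union> \<beta> n i) \<inter> M \<subseteq> z" for n
    proof -
      have "U (z \<union> \<beta> n i) \<subseteq> U (z \<union> \<beta> (Suc n) i)"
        unfolding U_def using b_Suc[OF i] by (intro fin_hull_mono) blast
      moreover have "U (z \<union> \<beta> (Suc n) i) \<inter> M \<subseteq> z" using leg[OF i] unfolding legal_def by blast
      ultimately show ?thesis by blast
    qed
    then show "x i \<inter> M \<subseteq> z" unfolding x_UN[OF i] by blast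
    show "z \<subseteq> x i \<inter> M" using zbx[OF i] zM by (auto simp: P_less_def)
  qed

  have "\<exists>i\<in>I. \<not> x i \<subseteq> e A ` z"
  proof (rule ccontr)
    assume "\<not> ?thesis"
    moreover have "i \<in> x i" if "i \<in> I" for i using b0[OF that] zbx[OF that] unfolding b_def by blast
    ultimately have "I \<subseteq> e A ` z" by blast
    then have "|I| \<le>o |z|" using ordLeq_transitive[OF card_of_mono1 card_of_image] by blast
    then have "|I| <o \<kappa>" using zM ordLeq_ordLess_trans unfolding P_less_def by blast
    then show False using cI not_ordLess_ordIso by blast
  qed
  then obtain i where i: "i \<in> I" "\<not> x i \<subseteq> e A ` z" by blast
  have "b i \<in> P_less \<nu> (x i)" using bnu[OF i(1)] zbx[OF i(1)] by (simp add: P_less_def)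
  then have "x i \<in> diagonal_family"
    using i xP[OF i(1)] xM[OF i(1)] zT closed xA[OF i(1)] A_eq[OF i(1)]
    unfolding diagonal_family_def by auto
  then show ?thesis using xC[OF i(1)] by blast
qed

lemma diagonal_family_nonreflecting_stationary: "nonreflecting_stationary \<kappa> \<mu> \<Lambda> diagonal_family"
  unfolding nonreflecting_stationary_def stationary_def[of \<kappa> L]
  using diagonal_family_meets_club diagonal_family_nonreflecting by (auto simp: diagonal_family_def)

end

section \<open>Choice of \<open>E\<close> and \<open>e\<close>\<close>

theorem theorem3:
  fixes \<nu> :: "'n rel" and \<kappa> :: "'k rel" and \<mu> \<Lambda> :: "'a rel"
    and c :: "'a \<Rightarrow> 'a set" and T :: "'a set set"
  assumes "Card_order \<nu>" and "regularCard \<nu>" and "cardSuc natLeq \<le>o \<nu>"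
    and "Card_order \<kappa>" and "regularCard \<kappa>" and "\<nu> <o \<kappa>"
    and "Card_order \<mu>" and "\<kappa> \<le>o \<mu>"
    and "Card_order \<Lambda>" and "\<mu> <o \<Lambda>" and "\<mu> initial_segment_of \<Lambda>"
    and "cov_eq \<Lambda> \<mu> \<nu>"
    and "\<forall>\<xi> \<in> Field \<mu>. c \<xi> \<in> P_less \<nu> (Field \<mu>)"
    and "stationary \<kappa> (Field \<mu>) T" and "|T| =o \<mu>"
    and "\<forall>z \<in> T. unbounded_in \<nu> z {c \<xi> | \<xi>. \<xi> \<in> z}"
  shows "\<exists>S. nonreflecting_stationary \<kappa> \<mu> \<Lambda> S"
proof -
  obtain E where E: "\<And>\<alpha>. \<alpha> \<in> Field \<Lambda> \<Longrightarrow> E \<alpha> \<in> P_eq \<mu> (Field \<Lambda>)"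
    and cov: "\<And>B. B \<in> P_eq \<mu> (Field \<Lambda>) \<Longrightarrow> \<exists>a\<in>P_less \<nu> (Field \<Lambda>). B \<subseteq> (\<Union>\<alpha>\<in>a. E \<alpha>)"
    using assms(12) unfolding cov_eq_def by blast
  have nu: "natLeq <o \<nu>"
    using ordLess_ordLeq_trans[OF cardSuc_greater[OF natLeq_Card_order] assms(3)] .
  have inf_nu: "\<not> finite (Field \<nu>)"
    using cinfinite_mono[OF ordLess_imp_ordLeq[OF nu] natLeq_cinfinite] by (simp add: cinfinite_def)
  have inf_kappa: "\<not> finite (Field \<kappa>)"
    using cinfinite_mono[OF ordLess_imp_ordLeq[OF assms(6)]] inf_nu by (simp add: cinfinite_def)
  have inf_mu: "\<not> finite (Field \<mu>)"
    using cinfinite_mono[OF assms(8)] inf_kappa by (simp add: cinfinite_def)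
  have card_M: "|Field \<mu>| =o \<mu>" using card_of_Field_ordIso[OF assms(7)] .
  have sub: "Field \<mu> \<subseteq> Field \<Lambda>"
    using assms(11) unfolding init_seg_of_def Field_def by blast
  \<comment> \<open>\<open>cov_eq\<close> concerns sets of size exactly \<open>\<mu>\<close>; adding
    \<open>Field \<mu>\<close> to \<open>G\<close> reaches that size.\<close>
  have cov': "\<exists>a\<in>P_less \<nu> (Field \<Lambda>). G \<subseteq> (\<Union>\<alpha>\<in>a. E \<alpha>)"
    if "G \<subseteq> Field \<Lambda>" "|G| \<le>o \<mu>" for G
  proof -
    have "|G \<union> Field \<mu>| \<le>o \<mu>"
      using that(2) ordIso_imp_ordLeq[OF card_M]
      by (intro card_of_Un_ordLeq_infinite_Field inf_mu assms(7))
    moreover have "\<mu> \<le>o |G \<union> Field \<mu>|"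
      by (rule ordIso_ordLeq_trans[OF ordIso_symmetric[OF card_M] card_of_mono1]) simp
    ultimately have "G \<union> Field \<mu> \<in> P_eq \<mu> (Field \<Lambda>)"
      using that(1) sub by (simp add: P_eq_def ordIso_iff_ordLeq)
    from cov[OF this] show ?thesis by blast
  qed
  \<comment> \<open>Inclusion instead of equality admits the empty \<open>B\<close>.\<close>
  have "\<exists>g. B \<subseteq> g ` Field \<mu>" if "|B| \<le>o \<mu>" for B :: "'a set"
  proof (cases "B = {}")
    case False
    have "|B| \<le>o |Field \<mu>|" using ordLeq_ordIso_trans[OF that ordIso_symmetric[OF card_M]] .
    then obtain g where "g ` Field \<mu> = B" using card_of_ordLeq2[OF False, of "Field \<mu>"] by auto
    then show ?thesis by blast
  qed simp
  then obtain e where e: "\<And>B :: 'a set. |B| \<le>o \<mu> \<Longrightarrow> B \<subseteq> e B ` Field \<mu>" by metis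
  interpret covering_setting \<nu> \<kappa> \<mu> \<Lambda> c T E e
  proof
    show "stable \<nu>" "stable \<kappa>"
      using regularCard_stable assms inf_nu inf_kappa by blast+
    show "E \<alpha> \<subseteq> Field \<Lambda>" "|E \<alpha>| \<le>o \<mu>" if "\<alpha> \<in> Field \<Lambda>" for \<alpha>
      using E[OF that] ordIso_imp_ordLeq by (auto simp: P_eq_def)
    show "|T| \<le>o \<mu>" using assms(15) by (rule ordIso_imp_ordLeq)
  qed (use assms nu sub cov' e in \<open>simp_all\<close>)
  show ?thesis using diagonal_family_nonreflecting_stationary by blast
qed

end
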